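(* Let $k\ge 2$ be an integer and $p_k(X)=X^k-2(X^{k-2}+X^{k-3}+\cdots+X+1)$. For $n\ge k$ let $$R_{2,3,\dots,k}(n)=\sum_{i=1}^{n}X_iX_{i+1}\cdots X_{i+k-1},$$ where indices are taken modulo $n$ with complete residue system $\{1,\dots,n\}$. Then the sequence $\{S(R_{2,3,\dots,k}(n))\}$ satisfies the homogeneous linear recurrence whose characteristic polynomial is $p_k(X)$.
   Context: Boolean functions in $n$ variables are maps $\mathbb{F}_2^n\to\mathbb{F}_2$ written as polynomials in $X_1,\dots,X_n$; $S(F)=\sum_{\mathbf{x}\in\mathbb{F}_2^n}(-1)^{F(\mathbf{x})}$. A sequence satisfies the homogeneous linear recurrence with characteristic polynomial $X^d-\sum_{i=1}^d c_iX^{d-i}$ if $a_n=\sum_{i=1}^d c_ia_{n-i}$ for all admissible $n$. *)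

theory Defs
  imports
    "HOL-Library.Z2"
    "HOL-Library.FuncSet"
    "HOL-Computational_Algebra.Polynomial"
begin

text \<open>The field with two elements is the type \<^typ>\<open>bit\<close>.  A point of its \<open>n\<close>-th power is
  an extensional function on the index set \<open>{1..n}\<close>.\<close>

definition F2_space :: "nat \<Rightarrow> (nat \<Rightarrow> bit) set" where
  "F2_space n = {1..n} \<rightarrow>\<^sub>E UNIV"

definition exp_sum :: "nat \<Rightarrow> ((nat \<Rightarrow> bit) \<Rightarrow> bit) \<Rightarrow> int" where
  "exp_sum n F = (\<Sum>x\<in>F2_space n. (-1) ^ (of_bool (F x = 1) :: nat))"

text \<open>The representative of \<open>j\<close> modulo \<open>n\<close> in \<open>{1..n}\<close>; only used for \<open>j \<ge> 1\<close> and \<open>n \<ge> 1\<close>,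
  so the subtraction on natural numbers does not truncate.\<close>

definition cyc_index :: "nat \<Rightarrow> nat \<Rightarrow> nat" where
  "cyc_index n j = (j - 1) mod n + 1"

text \<open>The rotation symmetric function written \<open>R\<^sub>2\<^sub>,\<^sub>3\<^sub>,\<^sub>\<dots>\<^sub>,\<^sub>k(n)\<close>.\<close>

definition rot_fun :: "nat \<Rightarrow> nat \<Rightarrow> (nat \<Rightarrow> bit) \<Rightarrow> bit" where
  "rot_fun k n x = (\<Sum>i=1..n. \<Prod>j=0..<k. x (cyc_index n (i + j)))"

definition p_poly :: "nat \<Rightarrow> int poly" where
  "p_poly k = monom 1 k - 2 * (\<Sum>j=0..k-2. monom 1 j)"

text \<open>The sequence \<open>a\<close> is considered from index \<open>n\<^sub>0\<close> on (its earlier values are irrelevant),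
  so the recurrence of order \<open>d\<close> is required exactly where all of \<open>n, n-1, \<dots>, n-d\<close> are at
  least \<open>n\<^sub>0\<close>.\<close>

definition satisfies_linear_recurrence ::
  "nat \<Rightarrow> (nat \<Rightarrow> int) \<Rightarrow> int poly \<Rightarrow> bool" where
  "satisfies_linear_recurrence n\<^sub>0 a p \<longleftrightarrow>
     (\<exists>d c. p = monom 1 d - (\<Sum>i=1..d. monom (c i) (d - i)) \<and>
            (\<forall>n\<ge>n\<^sub>0 + d. a n = (\<Sum>i=1..d. c i * a (n - i))))"

end

theory Submission
  imports Defs
begin

text \<open>Read a binary word cyclically with the automaton whose state is the length of the current
  run of ones, capped at \<open>k - 1\<close>; reading a further one in state \<open>k - 1\<close> completes a window of
  \<open>k\<close> ones and contributes a sign \<open>-1\<close>.  After \<open>k - 1\<close> letters the state has forgotten where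
  it started, so for \<open>n \<ge> k\<close> every word of length \<open>n\<close> has exactly one initial state to which it
  returns, and from there the sign picked up is that of \<open>(-1)\<^sup>R\<close>.  Hence the exponential sum is the
  trace of the \<open>n\<close>-th power of the signed \<open>k \<times> k\<close> transfer matrix, and this matrix is
  annihilated by \<open>p\<^sub>k\<close>.\<close>

section \<open>The run-length automaton, its signs and its transfer operator\<close>

definition next_state :: "nat \<Rightarrow> nat \<Rightarrow> bit \<Rightarrow> nat" where
  "next_state k i b = (if b = 1 then min (k - 1) (Suc i) else 0)"

definition step_sign :: "nat \<Rightarrow> nat \<Rightarrow> bit \<Rightarrow> int" where
  "step_sign k i b = (if b = 1 \<and> k \<le> Suc i then - 1 else 1)"

text \<open>The transfer matrix acting on column vectors: powers become \<open>^^\<close>, and an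
  entry is read off by applying a power to an indicator function.\<close>

definition transfer :: "nat \<Rightarrow> (nat \<Rightarrow> int) \<Rightarrow> nat \<Rightarrow> int" where
  "transfer k f i = (\<Sum>b\<in>UNIV. step_sign k i b * f (next_state k i b))"

fun state :: "nat \<Rightarrow> (nat \<Rightarrow> bit) \<Rightarrow> nat \<Rightarrow> nat \<Rightarrow> nat" where
  "state k x i 0 = i"
| "state k x i (Suc t) = next_state k (state k x i t) (x (Suc t))"

definition path_sign :: "nat \<Rightarrow> (nat \<Rightarrow> bit) \<Rightarrow> nat \<Rightarrow> nat \<Rightarrow> int" where
  "path_sign k x i n = (\<Prod>t<n. step_sign k (state k x i t) (x (Suc t)))"

definition bit_sign :: "bit \<Rightarrow> int" where
  "bit_sign b = (if b = 1 then - 1 else 1)"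

subsection \<open>The transfer operator\<close>

lemma UNIV_bit: "(UNIV :: bit set) = {0, 1}"
  by (auto intro: bit.exhaust)

lemma transfer_less:
  assumes "Suc i < k"
  shows "transfer k f i = f 0 + f (Suc i)"
  using assms by (simp add: transfer_def UNIV_bit step_sign_def next_state_def min_absorb2)

lemma transfer_last: "transfer (Suc l) f l = f 0 - f l"
  by (simp add: transfer_def UNIV_bit step_sign_def next_state_def)

text \<open>Split the words of length \<open>r\<close> read from state 0 by their first zero: the
  \<open>j\<close> letters after it start afresh from state 0, and the word without a zero ends in
  state \<open>r\<close>. As \<open>r < k\<close>, no sign arises before the first zero.\<close>

lemma transfer_funpow_0:
  assumes "r < k"
  shows "(transfer k ^^ r) f 0 = (\<Sum>j<r. (transfer k ^^ j) f 0) + f r"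
  using assms
proof (induction r arbitrary: f)
  case 0
  then show ?case by simp
next
  case (Suc r)
  have "(transfer k ^^ Suc r) f 0 = (transfer k ^^ r) (transfer k f) 0"
    by (simp add: funpow_Suc_right del: funpow.simps)
  also have "\<dots> = (\<Sum>j<r. (transfer k ^^ Suc j) f 0) + (f 0 + f (Suc r))"
    using Suc by (simp add: funpow_Suc_right transfer_less del: funpow.simps)
  also have "\<dots> = (\<Sum>j<Suc r. (transfer k ^^ j) f 0) + f (Suc r)"
    by (simp add: sum.lessThan_Suc_shift del: sum.lessThan_Suc)
  finally show ?case .
qed

text \<open>With \<open>k = Suc l\<close>, expanding \<open>l\<close> steps on
  \<open>transfer k f\<close> leaves \<open>f 0 - f l\<close>, while expanding \<open>l\<close>
  steps on \<open>f\<close> expresses \<open>f l\<close> through powers at 0. Eliminating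
  \<open>f l\<close> gives the relation.\<close>

lemma transfer_annihilated_0:
  assumes "0 < k"
  shows "(transfer k ^^ k) f 0 = 2 * (\<Sum>j<k - 1. (transfer k ^^ j) f 0)"
proof -
  from assms obtain l where k: "k = Suc l"
    by (cases k) auto
  let ?h = "\<lambda>j. (transfer k ^^ j) f 0"
  have "?h k = (transfer k ^^ l) (transfer k f) 0"
    by (simp add: k funpow_Suc_right del: funpow.simps)
  also have "\<dots> = (\<Sum>j<l. ?h (Suc j)) + (f 0 - f l)"
    by (subst transfer_funpow_0)
      (simp_all add: k funpow_Suc_right transfer_last del: funpow.simps(2))
  finally have "?h k = (\<Sum>j<l. ?h (Suc j)) + f 0 - f l"
    by simp
  moreover have "?h l = (\<Sum>j<l. ?h j) + f l"
    by (rule transfer_funpow_0) (simp add: k)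
  moreover have "(\<Sum>j<l. ?h (Suc j)) + f 0 = (\<Sum>j<l. ?h j) + ?h l"
    using sum.lessThan_Suc_shift[of ?h l] by simp
  ultimately show ?thesis
    by (simp add: k)
qed

text \<open>Since \<open>transfer k f i = f 0 + f (Suc i)\<close>, the relation at
  \<open>Suc i\<close> is the one at \<open>i\<close> for \<open>transfer k f\<close> minus the one
  at 0 for \<open>f\<close>. Hence \<open>f\<close> varies in the induction.\<close>

lemma transfer_annihilated:
  assumes "i < k"
  shows "(transfer k ^^ k) f i = 2 * (\<Sum>j<k - 1. (transfer k ^^ j) f i)"
  using assms
proof (induction i arbitrary: f)
  case 0
  then show ?case by (rule transfer_annihilated_0)
next
  case (Suc i)
  have less: "transfer k g i = g 0 + g (Suc i)" for g
    using Suc.prems by (rule transfer_less)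
  have "(transfer k ^^ k) (transfer k f) i =
      2 * (\<Sum>j<k - 1. (transfer k ^^ j) (transfer k f) i)"
    using Suc by simp
  moreover have "(transfer k ^^ j) (transfer k f) i =
      (transfer k ^^ j) f 0 + (transfer k ^^ j) f (Suc i)" for j
    by (simp flip: less funpow_swap1)
  moreover have "(transfer k ^^ k) f 0 = 2 * (\<Sum>j<k - 1. (transfer k ^^ j) f 0)"
    using Suc.prems by (intro transfer_annihilated_0) simp
  ultimately show ?case
    by (simp add: sum.distrib)
qed

lemma transfer_recurrence:
  assumes "i < k" "k \<le> n"
  shows "(transfer k ^^ n) f i = 2 * (\<Sum>j=2..k. (transfer k ^^ (n - j)) f i)"
proof -
  have "(transfer k ^^ n) f i = (transfer k ^^ k) ((transfer k ^^ (n - k)) f) i"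
    using assms by (simp flip: funpow_add comp_apply[of "transfer k ^^ k"])
  also have "\<dots> = 2 * (\<Sum>j<k - 1. (transfer k ^^ (j + (n - k))) f i)"
    using assms by (simp only: transfer_annihilated funpow_add comp_apply)
  also have "(\<Sum>j<k - 1. (transfer k ^^ (j + (n - k))) f i) =
      (\<Sum>j=2..k. (transfer k ^^ (n - j)) f i)"
    using assms by (intro sum.reindex_bij_witness[of _ "\<lambda>j. k - j" "\<lambda>j. k - j"]) (auto simp: add.commute)
  finally show ?thesis .
qed

subsection \<open>Words as paths\<close>

lemma state_cong:
  "(\<And>t. t \<in> {1..n} \<Longrightarrow> x t = y t) \<Longrightarrow> state k x i n = state k y i n"
  by (induction n) auto

lemma path_sign_cong:
  assumes "\<And>t. t \<in> {1..n} \<Longrightarrow> x t = y t"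
  shows "path_sign k x i n = path_sign k y i n"
proof -
  have "state k x i t = state k y i t" if "t < n" for t
    using assms that by (intro state_cong) auto
  then show ?thesis
    using assms by (simp add: path_sign_def)
qed

lemma sum_F2_space_Suc:
  "(\<Sum>x\<in>F2_space (Suc n). h x) = (\<Sum>x\<in>F2_space n. \<Sum>b\<in>UNIV. h (x(Suc n := b)))"
proof -
  have "F2_space (Suc n) = (\<lambda>(b, x). x(Suc n := b)) ` (UNIV \<times> F2_space n)"
    unfolding F2_space_def
    by (simp add: atLeastAtMostSuc_conv PiE_insert_eq)
  moreover have "inj_on (\<lambda>(b, x). x(Suc n := b)) (UNIV \<times> F2_space n)"
    unfolding F2_space_def by (rule inj_combinator) simp
  ultimately have "(\<Sum>x\<in>F2_space (Suc n). h x) =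
      (\<Sum>(b, x)\<in>UNIV \<times> F2_space n. h (x(Suc n := b)))"
    by (simp add: sum.reindex case_prod_unfold)
  also have "\<dots> = (\<Sum>b\<in>UNIV. \<Sum>x\<in>F2_space n. h (x(Suc n := b)))"
    by (simp add: sum.cartesian_product)
  also have "\<dots> = (\<Sum>x\<in>F2_space n. \<Sum>b\<in>UNIV. h (x(Suc n := b)))"
    by (rule sum.swap)
  finally show ?thesis .
qed

text \<open>Summing over the last letter replaces \<open>f\<close> by \<open>transfer k f\<close>,
  because the earlier letters alone fix the state and sign reached before it.\<close>

lemma sum_path_sign:
  "(\<Sum>x\<in>F2_space n. path_sign k x i n * f (state k x i n)) = (transfer k ^^ n) f i"
proof (induction n arbitrary: f)
  case 0
  then show ?case by (simp add: F2_space_def path_sign_def)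
next
  case (Suc n)
  have *: "state k (x(Suc n := b)) i n = state k x i n"
    "path_sign k (x(Suc n := b)) i n = path_sign k x i n" for x b
    by (auto intro!: state_cong path_sign_cong)
  have "path_sign k (x(Suc n := b)) i (Suc n) =
      path_sign k (x(Suc n := b)) i n * step_sign k (state k (x(Suc n := b)) i n) b" for x b
    by (simp add: path_sign_def)
  then have "(\<Sum>x\<in>F2_space (Suc n). path_sign k x i (Suc n) * f (state k x i (Suc n))) =
      (\<Sum>x\<in>F2_space n. path_sign k x i n * transfer k f (state k x i n))"
    by (simp add: sum_F2_space_Suc * transfer_def sum_distrib_left mult.assoc)
  then show ?case
    using Suc[of "transfer k f"] by (simp add: funpow_swap1)
qed

lemma state_less: "0 < k \<Longrightarrow> i < k \<Longrightarrow> state k x i t < k"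
  by (induction t) (auto simp: next_state_def)

text \<open>A zero resets the run, so the last \<open>r\<close> letters decide. The bound
  \<open>r \<le> t\<close> ensures that they have all been read, and \<open>r < k\<close> that the
  cap does not interfere.\<close>

lemma le_state_iff:
  "r \<le> t \<Longrightarrow> r < k \<Longrightarrow> r \<le> state k x i t \<longleftrightarrow> (\<forall>s<r. x (t - s) = 1)"
proof (induction t arbitrary: r)
  case 0
  then show ?case by simp
next
  case (Suc t)
  show ?case
  proof (cases r)
    case (Suc r')
    have "(\<forall>s<Suc r'. x (Suc t - s) = 1) \<longleftrightarrow> x (Suc t) = 1 \<and> (\<forall>s<r'. x (t - s) = 1)"
      by (simp add: All_less_Suc2)
    then show ?thesis
      using Suc Suc.IH[of r'] Suc.prems by (auto simp: next_state_def)
  qed simp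
qed

lemma state_independent:
  assumes "k \<le> Suc t" "i < k" "j < k"
  shows "state k x i t = state k x j t"
proof (rule order.antisym)
  have less: "state k x i t < k" "state k x j t < k"
    using assms by (auto intro: state_less)
  show "state k x i t \<le> state k x j t" "state k x j t \<le> state k x i t"
    \<comment> \<open>Each state is at most \<open>k - 1 \<le> t\<close>, so it can itself serve as
      \<open>r\<close>; the criterion on the letters does not mention the start.\<close>
    using le_state_iff[of "state k x i t" t k x] le_state_iff[of "state k x j t" t k x] less assms
    by (metis less_Suc_eq_le order.strict_trans2 order.refl)+
qed

subsection \<open>Periodic words\<close>

lemma state_periodic:
  assumes "\<And>t. 0 < t \<Longrightarrow> x (t + n) = x t" "state k x i n = i"
  shows "state k x i (t + n) = state k x i t"
  using assms(1)[of "Suc _"] assms(2) by (induction t) auto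

lemma bit_sign_sum: "finite A \<Longrightarrow> bit_sign (\<Sum>i\<in>A. f i) = (\<Prod>i\<in>A. bit_sign (f i))"
proof (induction A rule: finite_induct)
  case (insert a A)
  have "bit_sign (b + c) = bit_sign b * bit_sign c" for b c
    by (cases b; cases c) (simp_all add: bit_sign_def)
  with insert show ?case by simp
qed (simp add: bit_sign_def)

text \<open>Raising \<open>c\<close> by one trades the factor \<open>F c\<close> for
  \<open>F (c + n)\<close>. This reconciles signs, which arise at the ends of windows, with
  \<open>rot_fun\<close>, which lists windows by their starts.\<close>

lemma prod_periodic_shift:
  fixes F :: "nat \<Rightarrow> 'a::comm_monoid_mult"
  assumes "\<And>t. F (t + n) = F t"
  shows "(\<Prod>t<n. F (t + c)) = (\<Prod>t<n. F t)"
proof (induction c)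
  case (Suc c)
  have "(\<Prod>t<n. F (t + Suc c)) = (\<Prod>t<n. F (t + c))"
  proof (cases n)
    case (Suc m)
    have "F (m + Suc c) = F c"
      using assms[of c] by (simp add: Suc add.commute)
    then have "(\<Prod>t<n. F (t + Suc c)) = F c * (\<Prod>t<m. F (Suc t + c))"
      by (simp add: Suc mult.commute)
    also have "\<dots> = (\<Prod>t<n. F (t + c))"
      unfolding Suc prod.lessThan_Suc_shift by simp
    finally show ?thesis .
  qed simp
  with Suc show ?case by simp
qed simp

lemma path_sign_periodic:
  assumes k: "0 < k" "k \<le> n" and i: "i < k" and ret: "state k y i n = i"
    and per: "\<And>t. 0 < t \<Longrightarrow> y (t + n) = y t"
  shows "path_sign k y i n = bit_sign (\<Sum>t=1..n. \<Prod>j=0..<k. y (t + j))"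
proof -
  define F where "F t = bit_sign (\<Prod>j=0..<k. y (Suc t + j))" for t
  have prod1: "(\<Prod>j\<in>A. g j) = 1 \<longleftrightarrow> (\<forall>j\<in>A. g j = 1)" if "finite A" for A and g :: "nat \<Rightarrow> bit"
    using that by (induction A) auto
  \<comment> \<open>The window ending at letter \<open>Suc t\<close> would begin at
    \<open>t + 2 - k\<close>, possibly before the first letter. One period later it begins at
    \<open>Suc (t + (n + 1 - k))\<close>, without truncation since \<open>k \<le> n\<close>.\<close>
  have "step_sign k (state k y i t) (y (Suc t)) = F (t + (n + 1 - k))" for t
  proof -
    have st: "state k y i (t + n) = state k y i t"
      by (rule state_periodic[OF per ret])
    have "k \<le> Suc (state k y i t) \<longleftrightarrow> (\<forall>s<k - 1. y (t + n - s) = 1)"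
    proof -
      \<comment> \<open>At time \<open>t\<close> fewer than \<open>k - 1\<close> letters may have
        been read; at time \<open>t + n\<close> there are enough.\<close>
      have "k - 1 \<le> state k y i (t + n) \<longleftrightarrow> (\<forall>s<k - 1. y (t + n - s) = 1)"
        using k by (intro le_state_iff) auto
      moreover have "k \<le> Suc m \<longleftrightarrow> k - 1 \<le> m" for m
        by auto
      ultimately show ?thesis
        by (simp only: st)
    qed
    moreover have "y (Suc t) = y (Suc (t + n))"
      using per[of "Suc t"] by simp
    ultimately have "(y (Suc t) = 1 \<and> k \<le> Suc (state k y i t)) \<longleftrightarrow>
        (\<forall>s<Suc (k - 1). y (Suc (t + n) - s) = 1)"
      by (simp add: All_less_Suc2)
    \<comment> \<open>Counting back \<open>s\<close> from the end of the window is counting forward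
      \<open>j = k - 1 - s\<close> from its start.\<close>
    also have "\<dots> \<longleftrightarrow> (\<forall>j\<in>{0..<k}. y (Suc (t + (n + 1 - k)) + j) = 1)"
    proof safe
      fix j assume "\<forall>s<Suc (k - 1). y (Suc (t + n) - s) = 1" "j \<in> {0..<k}"
      then show "y (Suc (t + (n + 1 - k)) + j) = 1"
        using k by (auto dest!: spec[of _ "k - 1 - j"] simp: Suc_diff_le)
    next
      fix s assume *: "\<forall>j\<in>{0..<k}. y (Suc (t + (n + 1 - k)) + j) = 1" "s < Suc (k - 1)"
      then have "k - 1 - s \<in> {0..<k}" "Suc (t + (n + 1 - k)) + (k - 1 - s) = Suc (t + n) - s"
        using k by auto
      with * show "y (Suc (t + n) - s) = 1"
        by metis
    qed
    finally show ?thesis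
      by (simp add: step_sign_def F_def bit_sign_def prod1)
  qed
  then have "path_sign k y i n = (\<Prod>t<n. F (t + (n + 1 - k)))"
    by (simp add: path_sign_def)
  also have "\<dots> = (\<Prod>t<n. F t)"
  proof (rule prod_periodic_shift)
    fix t
    have "y (Suc (t + n) + j) = y (Suc t + j)" for j
      using per[of "Suc t + j"] by (simp add: ac_simps)
    then show "F (t + n) = F t"
      by (simp add: F_def)
  qed
  also have "\<dots> = (\<Prod>t=1..n. bit_sign (\<Prod>j=0..<k. y (t + j)))"
    by (simp add: F_def prod.atLeast1_atMost_eq)
  also have "\<dots> = bit_sign (\<Sum>t=1..n. \<Prod>j=0..<k. y (t + j))"
    by (simp add: bit_sign_sum)
  finally show ?thesis .
qed

text \<open>All starting states lead to the same state \<open>i0\<close> after \<open>n\<close>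
  letters, so only the path from \<open>i0\<close> closes up and a single term survives.\<close>

lemma sum_closed_paths:
  assumes "0 < k" "k \<le> n"
  shows "(\<Sum>i<k. path_sign k x i n * of_bool (state k x i n = i)) = bit_sign (rot_fun k n x)"
proof -
  define y where "y t = x (cyc_index n t)" for t
  define i0 where "i0 = state k y 0 n"
  have xy: "x t = y t" if "t \<in> {1..n}" for t
    using that by (auto simp: y_def cyc_index_def)
  \<comment> \<open>Restricted to positive \<open>t\<close>: truncated subtraction makes
    \<open>cyc_index n 0\<close> equal to 1 rather than \<open>n\<close>.\<close>
  have per: "y (t + n) = y t" if "0 < t" for t
  proof -
    have "t + n - 1 = (t - 1) + n" using that by simp
    then show ?thesis by (simp add: y_def cyc_index_def)
  qed
  have i0: "i0 < k"
    using assms by (simp add: i0_def state_less)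
  have st: "state k y i n = i0" if "i < k" for i
    unfolding i0_def using assms that by (intro state_independent) auto
  have "(\<Sum>i<k. path_sign k x i n * of_bool (state k x i n = i)) =
      (\<Sum>i<k. path_sign k y i n * of_bool (i0 = i))"
    using st state_cong[OF xy] path_sign_cong[OF xy] by simp
  also have "\<dots> = path_sign k y i0 n"
    using i0 by (simp add: of_bool_def if_distrib cong: if_cong)
  also have "\<dots> = bit_sign (rot_fun k n x)"
    using path_sign_periodic[OF assms i0 st[OF i0] per] unfolding rot_fun_def y_def by simp
  finally show ?thesis .
qed

section \<open>The exponential sum as a trace, and its recurrence\<close>

lemma exp_sum_rot_fun:
  assumes "0 < k" "k \<le> n"
  shows "exp_sum n (rot_fun k n) = (\<Sum>i<k. (transfer k ^^ n) (\<lambda>j. of_bool (j = i)) i)"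
proof -
  have "exp_sum n (rot_fun k n) = (\<Sum>x\<in>F2_space n. bit_sign (rot_fun k n x))"
    unfolding exp_sum_def by (intro sum.cong refl) (simp add: bit_sign_def)
  also have "\<dots> = (\<Sum>x\<in>F2_space n. \<Sum>i<k. path_sign k x i n * of_bool (state k x i n = i))"
    by (simp only: sum_closed_paths[OF assms])
  also have "\<dots> = (\<Sum>i<k. \<Sum>x\<in>F2_space n. path_sign k x i n * of_bool (state k x i n = i))"
    by (rule sum.swap)
  \<comment> \<open>For fixed \<open>i\<close> the inner sum is the \<open>i\<close>-th diagonal
    entry of the \<open>n\<close>-th power.\<close>
  also have "\<dots> = (\<Sum>i<k. (transfer k ^^ n) (\<lambda>j. of_bool (j = i)) i)"
    using sum_path_sign[of k _ n "\<lambda>j. of_bool (j = _)"] by simp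
  finally show ?thesis .
qed

theorem theorem2p3:
  fixes k :: nat
  assumes "k \<ge> 2"
  shows "satisfies_linear_recurrence k (\<lambda>n. exp_sum n (rot_fun k n)) (p_poly k)"
proof -
  \<comment> \<open>The value 0 at 1 reflects the missing term of degree \<open>k - 1\<close> in
    \<open>p_poly k\<close>.\<close>
  define c :: "nat \<Rightarrow> int" where "c i = (if i = 1 then 0 else 2)" for i
  have split: "{1..k} = insert 1 {2..k}"
    using assms by auto
  have "(\<Sum>i=1..k. monom (c i) (k - i)) = (\<Sum>i=2..k. monom 2 (k - i))"
    unfolding split by (simp add: c_def)
  also have "\<dots> = (\<Sum>j=0..k-2. monom 2 j)"
    by (rule sum.reindex_bij_witness[of _ "\<lambda>j. k - j" "\<lambda>j. k - j"]) (use assms in auto)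
  also have "\<dots> = 2 * (\<Sum>j=0..k-2. monom 1 j)"
  proof -
    have "monom (2::int) j = 2 * monom 1 j" for j
      by (metis add_monom mult_2 one_add_one)
    then show ?thesis
      by (simp add: sum_distrib_left)
  qed
  finally have "p_poly k = monom 1 k - (\<Sum>i=1..k. monom (c i) (k - i))"
    by (simp add: p_poly_def)
  \<comment> \<open>The bound \<open>k + k \<le> n\<close> keeps every \<open>n - j\<close> with
    \<open>j \<le> k\<close> at least \<open>k\<close>, where the trace formula is
    available.\<close>
  moreover have "exp_sum n (rot_fun k n) =
      (\<Sum>i=1..k. c i * exp_sum (n - i) (rot_fun k (n - i)))" if "k + k \<le> n" for n
  proof -
    let ?e = "\<lambda>i j::nat. of_bool (j = i) :: int"
    have "exp_sum n (rot_fun k n) = (\<Sum>i<k. (transfer k ^^ n) (?e i) i)"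
      using assms that by (intro exp_sum_rot_fun) auto
    also have "\<dots> = (\<Sum>i<k. 2 * (\<Sum>j=2..k. (transfer k ^^ (n - j)) (?e i) i))"
      using that by (intro sum.cong refl transfer_recurrence) auto
    also have "\<dots> = 2 * (\<Sum>j=2..k. \<Sum>i<k. (transfer k ^^ (n - j)) (?e i) i)"
      by (subst sum.swap) (simp add: sum_distrib_left)
    also have "\<dots> = 2 * (\<Sum>j=2..k. exp_sum (n - j) (rot_fun k (n - j)))"
      using assms that
      by (intro arg_cong[where f = "(*) 2"] sum.cong refl exp_sum_rot_fun[symmetric]) auto
    also have "\<dots> = (\<Sum>i=1..k. c i * exp_sum (n - i) (rot_fun k (n - i)))"
      unfolding split by (simp add: c_def sum_distrib_left)
    finally show ?thesis .
  qed
  ultimately show ?thesis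
    unfolding satisfies_linear_recurrence_def by blast
qed

end
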